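(* Let $(\Omega,\mathcal F,\mathbb P)$ be a probability space and $Y$ a random variable. For any $\sigma$-lattice $\mathcal A\subseteq\mathcal F$, the isotonic conditional law (ICL) $P_{Y\mid\mathcal A}$ is threshold calibrated, that is, $$P_{Y\mid\mathcal A}(y)=\mathbb P(Y\le y\mid P_{Y\mid\mathcal A}(y))\quad\text{almost surely for all }y\in\mathbb R.$$
   Context: A $\sigma$-lattice $\mathcal A\subseteq\mathcal F$ contains $\emptyset,\Omega$ and is closed under countable unions and intersections. A random variable $X$ is $\mathcal A$-measurable if $\{X>x\}\in\mathcal A$ for all $x\in\mathbb R$. For integrable $Z$, $\mathbb E(Z\mid\mathcal A)$ is the (a.s. unique) integrable $\mathcal A$-measurable random variable $X$ with $\mathbb E(Z\mathbf 1_A)\le\mathbb E(X\mathbf 1_A)$ for all $A\in\mathcal A$ and $\mathbb E(X\mathbf 1_B)=\mathbb E(Z\mathbf 1_B)$ for all $B\in\sigma(X)$; $\mathbb P(B\mid\mathcal A)=\mathbb E(\mathbf 1_B\mid\mathcal A)$. The ICL $P_{Y\mid\mathcal A}$ is the (a.s. unique) Markov kernel from $(\Omega,\mathcal F)$ to $(\mathbb R,\mathcal B(\mathbb R))$ such that $P_{Y\mid\mathcal A}(\cdot,(y,\infty))$ is a version of $\mathbb P(Y>y\mid\mathcal A)$ for every $y\in\mathbb R$. $P_{Y\mid\mathcal A}(y)$ abbreviates the random variable $P_{Y\mid\mathcal A}(\cdot,(-\infty,y])$. Conditioning on a random variable, as in $\mathbb P(\cdot\mid P_{Y\mid\mathcal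 A}(y))$, is classical conditioning on the $\sigma$-algebra it generates. *)

theory Defs
  imports "HOL-Probability.Probability"
begin

definition sigma_lattice :: "'a measure \<Rightarrow> 'a set set \<Rightarrow> bool" where
  "sigma_lattice M \<A> \<longleftrightarrow>
     \<A> \<subseteq> sets M \<and> {} \<in> \<A> \<and> space M \<in> \<A> \<and>
     (\<forall>A :: nat \<Rightarrow> 'a set. range A \<subseteq> \<A> \<longrightarrow> (\<Union>n. A n) \<in> \<A> \<and> (\<Inter>n. A n) \<in> \<A>)"

definition lattice_measurable :: "'a measure \<Rightarrow> 'a set set \<Rightarrow> ('a \<Rightarrow> real) \<Rightarrow> bool" where
  "lattice_measurable M \<A> X \<longleftrightarrow> (\<forall>x. {\<omega> \<in> space M. X \<omega> > x} \<in> \<A>)"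

definition generated_algebra :: "'a measure \<Rightarrow> ('a \<Rightarrow> real) \<Rightarrow> 'a measure" where
  "generated_algebra M X = vimage_algebra (space M) X borel"

definition is_lattice_cond_exp ::
  "'a measure \<Rightarrow> 'a set set \<Rightarrow> ('a \<Rightarrow> real) \<Rightarrow> ('a \<Rightarrow> real) \<Rightarrow> bool" where
  "is_lattice_cond_exp M \<A> Z X \<longleftrightarrow>
     integrable M Z \<and> integrable M X \<and> lattice_measurable M \<A> X \<and>
     (\<forall>A\<in>\<A>. (\<integral>\<omega>. Z \<omega> * indicator A \<omega> \<partial>M) \<le> (\<integral>\<omega>. X \<omega> * indicator A \<omega> \<partial>M)) \<and>
     (\<forall>B\<in>sets (generated_algebra M X).
        (\<integral>\<omega>. X \<omega> * indicator B \<omega> \<partial>M) = (\<integral>\<omega>. Z \<omega> * indicator B \<omega> \<partial>M))"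

text \<open>The conditional expectation is a class of random variables up to almost sure equality,
  and a version is any member of this class. The almost sure equality in the next definition
  cannot be replaced by the requirement that the kernel itself yield lattice-measurable functions:
  for the Lebesgue measure on (0,1], the lattice of up-sets, and Y = 1/(1-w) for w < 1,
  every increasing version of P(Y > y | A) is at least 1 at the point 1, for all y, so that no
  kernel of probability measures would exist.\<close>

definition is_ICL ::
  "'a measure \<Rightarrow> 'a set set \<Rightarrow> ('a \<Rightarrow> real) \<Rightarrow> ('a \<Rightarrow> real measure) \<Rightarrow> bool" where
  "is_ICL M \<A> Y K \<longleftrightarrow>
     K \<in> M \<rightarrow>\<^sub>M prob_algebra borel \<and>
     (\<forall>y. \<exists>X. is_lattice_cond_exp M \<A> (indicator {\<omega> \<in> space M. Y \<omega> > y}) X \<and>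
            (AE \<omega> in M. measure (K \<omega>) {y<..} = X \<omega>))"

definition cond_prob_given ::
  "'a measure \<Rightarrow> 'a set \<Rightarrow> ('a \<Rightarrow> real) \<Rightarrow> 'a \<Rightarrow> real" where
  "cond_prob_given M B V = real_cond_exp M (generated_algebra M V) (indicator B)"

text \<open>The quantifier over the thresholds stands outside the almost sure statement: the
  conditional probability on the right is only determined up to a null set depending on y.\<close>

definition threshold_calibrated ::
  "'a measure \<Rightarrow> ('a \<Rightarrow> real) \<Rightarrow> ('a \<Rightarrow> real measure) \<Rightarrow> bool" where
  "threshold_calibrated M Y K \<longleftrightarrow>
     (\<forall>y. AE \<omega> in M.
        measure (K \<omega>) {..y} =
        cond_prob_given M {\<omega>' \<in> space M. Y \<omega>' \<le> y} (\<lambda>\<omega>'. measure (K \<omega>') {..y}) \<omega>)"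

end

theory Submission
  imports Defs
begin

text \<open>Fix a threshold \<open>y\<close> and let \<open>X\<close> be a version of the lattice
  conditional expectation of the indicator of \<open>Y > y\<close>. Its second defining property,
  equal integrals over all events of the \<sigma>-algebra generated by \<open>X\<close>, says that
  \<open>X\<close> is the classical conditional probability of \<open>Y > y\<close> given
  \<open>X\<close> itself. Since the kernel takes probability measures as values, \<open>V\<close>,
  its mass on \<open>{..y}\<close>, is almost surely \<open>1 - X\<close>. The reflection x -> 1 - x
  turns events of \<open>V\<close> into events of \<open>X\<close> up to null sets, so passing to
  complements shows that \<open>V\<close> is the conditional probability of \<open>Y \<le> y\<close>
  given \<open>V\<close>.\<close>

lemma sets_generated_algebra:
  "sets (generated_algebra M X) = {X -` B \<inter> space M | B. B \<in> sets borel}"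
  unfolding generated_algebra_def by (rule sets_vimage_algebra2) auto

text \<open>This gives access to the characterization of \<open>real_cond_exp\<close> by integrals
  over events of the subalgebra.\<close>

lemma (in prob_space) finite_measure_subalgebra_generated:
  assumes "V \<in> borel_measurable M"
  shows "finite_measure_subalgebra M (generated_algebra M V)"
proof unfold_locales
  show "subalgebra M (generated_algebra M V)"
    using assms
    by (auto simp: subalgebra_def sets_generated_algebra measurable_sets)
      (simp_all add: generated_algebra_def)
qed

theorem proposition5p1:
  fixes M :: "'a measure" and Y :: "'a \<Rightarrow> real" and \<A> :: "'a set set"
    and K :: "'a \<Rightarrow> real measure"
  assumes "prob_space M"
    and "Y \<in> borel_measurable M"
    and "sigma_lattice M \<A>"
    and "is_ICL M \<A> Y K"
  shows "threshold_calibrated M Y K"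
  unfolding threshold_calibrated_def
proof
  fix y :: real
  interpret prob_space M by fact
  define V where "V = (\<lambda>\<omega>. measure (K \<omega>) {..y})"
  define G where "G = {\<omega> \<in> space M. Y \<omega> > y}"
  define L where "L = {\<omega> \<in> space M. Y \<omega> \<le> y}"
  have K [measurable]: "K \<in> M \<rightarrow>\<^sub>M prob_algebra borel"
    using assms(4) by (simp add: is_ICL_def)
  then have K' [measurable]: "K \<in> M \<rightarrow>\<^sub>M subprob_algebra borel"
    by (rule measurable_prob_algebraD)
  have V [measurable]: "V \<in> borel_measurable M"
    unfolding V_def by measurable
  have LG [measurable]: "G \<in> sets M" "L \<in> sets M"
    using assms(2) by (simp_all add: G_def L_def)
  obtain X where X: "is_lattice_cond_exp M \<A> (indicator G) X"
    and ae: "AE \<omega> in M. measure (K \<omega>) {y<..} = X \<omega>"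
    using assms(4) unfolding is_ICL_def G_def by blast
  have intX: "integrable M X"
    and calX: "\<And>B. B \<in> sets (generated_algebra M X) \<Longrightarrow>
      (\<integral>\<omega>. X \<omega> * indicator B \<omega> \<partial>M) = (\<integral>\<omega>. indicator G \<omega> * indicator B \<omega> \<partial>M)"
    using X by (auto simp: is_lattice_cond_exp_def)
  \<comment> \<open>The equality is only almost sure because the kernel agrees with \<open>X\<close>
    only off a null set; where it does, \<open>{..y}\<close> is the complement of
    \<open>{y<..}\<close> under a probability measure.\<close>
  have VX: "AE \<omega> in M. V \<omega> = 1 - X \<omega>"
    using ae
  proof (rule AE_mp, intro AE_I2 impI)
    fix \<omega> assume \<omega>: "\<omega> \<in> space M" and eq: "measure (K \<omega>) {y<..} = X \<omega>"
    have "K \<omega> \<in> space (prob_algebra borel)"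
      using K \<omega> by (rule measurable_space)
    then have "prob_space (K \<omega>)" and sets: "sets (K \<omega>) = sets borel"
      by (auto simp: space_prob_algebra)
    interpret K: prob_space "K \<omega>" by fact
    have "space (K \<omega>) - {y<..} = {..y}"
      using sets_eq_imp_space_eq[OF sets] by auto
    then show "V \<omega> = 1 - X \<omega>"
      using K.prob_compl[of "{y<..}"] sets eq by (simp add: V_def)
  qed
  have intV: "integrable M V"
    using VX intX by (subst integrable_cong_AE[where g = "\<lambda>\<omega>. 1 - X \<omega>"]) auto
  interpret S: finite_measure_subalgebra M "generated_algebra M V"
    by (rule finite_measure_subalgebra_generated) fact
  have "AE \<omega> in M. real_cond_exp M (generated_algebra M V) (indicator L) \<omega> = V \<omega>"
  proof (rule S.real_cond_exp_charact)
    fix A assume "A \<in> sets (generated_algebra M V)"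
    then obtain B where B [measurable]: "B \<in> sets borel" and A: "A = V -` B \<inter> space M"
      by (auto simp: sets_generated_algebra)
    have A_sets [measurable]: "A \<in> sets M" unfolding A by measurable
    \<comment> \<open>\<open>X\<close> is calibrated only on its own events, so \<open>A\<close> is replaced by
      an event of \<open>X\<close> that is almost surely equal to it.\<close>
    define C where "C = X -` ((\<lambda>x. 1 - x) -` B) \<inter> space M"
    have "(\<lambda>x::real. 1 - x) -` B \<in> sets borel"
      using measurable_sets[of "\<lambda>x::real. 1 - x" borel borel B] by simp
    then have C: "C \<in> sets (generated_algebra M X)" and C_sets [measurable]: "C \<in> sets M"
      using intX by (auto simp: C_def sets_generated_algebra)
    have intC: "integrable M (indicator C :: 'a \<Rightarrow> real)"
      and intG: "integrable M (indicator G :: 'a \<Rightarrow> real)"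
      by (simp_all add: emeasure_eq_measure)
    \<comment> \<open>Almost surely \<open>A\<close> equals \<open>C\<close> and \<open>V\<close>
      equals \<open>1 - X\<close>. The integral of \<open>X\<close> over \<open>C\<close> can then
      be traded for that of the indicator of \<open>G\<close> by \<open>calX\<close>.\<close>
    have "(LINT \<omega>:A|M. V \<omega>) = (\<integral>\<omega>. indicator C \<omega> - X \<omega> * indicator C \<omega> \<partial>M)"
      unfolding set_lebesgue_integral_def
    proof (rule integral_cong_AE)
      show "AE \<omega> in M. indicator A \<omega> *\<^sub>R V \<omega> = indicator C \<omega> - X \<omega> * indicator C \<omega>"
        using VX by eventually_elim (auto simp: A C_def indicator_def)
    qed (use intX in auto)
    also have "\<dots> = (\<integral>\<omega>. indicator C \<omega> \<partial>M) - (\<integral>\<omega>. indicator G \<omega> * indicator C \<omega> \<partial>M)"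
      using integrable_real_mult_indicator[OF C_sets intX] intC
      by (simp add: calX[OF C])
    also have "\<dots> = (\<integral>\<omega>. indicator C \<omega> - indicator G \<omega> * indicator C \<omega> \<partial>M)"
      using integrable_real_mult_indicator[OF C_sets intG] intC by simp
    \<comment> \<open>\<open>L\<close> is the complement of \<open>G\<close> in the space, so
      removing \<open>G\<close> from \<open>C\<close> leaves the part of \<open>C\<close> in
      \<open>L\<close>; \<open>C\<close> is then exchanged back for \<open>A\<close>.\<close>
    also have "\<dots> = (LINT \<omega>:A|M. indicator L \<omega>)"
      unfolding set_lebesgue_integral_def
    proof (rule integral_cong_AE)
      show "AE \<omega> in M. indicator C \<omega> - indicator G \<omega> * indicator C \<omega>
          = (indicator A \<omega> *\<^sub>R indicator L \<omega> :: real)"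
        using VX by eventually_elim (auto simp: A C_def G_def L_def indicator_def)
    qed auto
    finally show "(LINT \<omega>:A|M. indicator L \<omega>) = (LINT \<omega>:A|M. V \<omega>)" ..
  next
    show "V \<in> borel_measurable (generated_algebra M V)"
      unfolding generated_algebra_def by (rule measurable_vimage_algebra1) auto
  qed (use intV in \<open>simp_all add: emeasure_eq_measure\<close>)
  then show "AE \<omega> in M. measure (K \<omega>) {..y} =
      cond_prob_given M {\<omega>' \<in> space M. Y \<omega>' \<le> y} (\<lambda>\<omega>'. measure (K \<omega>') {..y}) \<omega>"
    by (simp add: cond_prob_given_def V_def L_def eq_commute)
qed

end
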